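(* For the Poisson $i\mathcal{S}$-graph with legitimate-node density $\lambda_\ell>0$ and eavesdropper density $\lambda_{\mathrm e}>0$ (secrecy rate threshold zero, path loss only, equal noise powers), the average out-degree of a typical node is $$\mathbb{E}\{N_{\mathrm{out}}\}=\frac{\lambda_\ell}{\lambda_{\mathrm e}},$$ and the probability $p_{\mathrm{out-isol}}=\mathbb{P}\{N_{\mathrm{out}}=0\}$ that a typical node cannot transmit to anyone with positive secrecy rate (out-isolation) is $$p_{\mathrm{out-isol}}=\frac{\lambda_{\mathrm e}}{\lambda_\ell+\lambda_{\mathrm e}}.$$
   Context: Poisson $i\mathcal{S}$-graph (zero threshold, path loss only, equal noise powers): $\Pi_\ell$ (legitimate nodes) and $\Pi_{\mathrm e}$ (eavesdroppers) are mutually independent homogeneous Poisson point processes on $\mathbb{R}^2$ with densities $\lambda_\ell$ and $\lambda_{\mathrm e}$. There is a directed edge $\overrightarrow{xy}$ between distinct legitimate nodes $x,y$ if and only if the maximum secrecy rate of the link is positive, which in this setting is equivalent to $|x-y|<\min_{e\in\Pi_{\mathrm e}}|x-e|$. Typical node: the node at the origin when the graph is built on the legitimate-node set $\Pi_\ell\cup\{0\}$ with eavesdroppers $\Pi_{\mathrm e}$. Its out-degree $N_{\mathrm{out}}$ is the number of $x\in\Pi_\ell$ with an edge $\overrightarrow{0x}$. *)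

theory Defs
  imports "HOL-Probability.Probability"
begin

section \<open>Poisson point processes\<close>

definition locally_finite :: "'a::metric_space set \<Rightarrow> bool" where
  "locally_finite S \<longleftrightarrow> (\<forall>B. bounded B \<longrightarrow> finite (S \<inter> B))"

(* The space of point configurations, with the sigma-algebra generated by the counting maps
   S |-> card (S Int B) for bounded Borel B. *)
definition config_space :: "'a::euclidean_space set measure" where
  "config_space =
     sigma {S. locally_finite S}
       {{S. locally_finite S \<and> card (S \<inter> B) = k} | B k. B \<in> sets borel \<and> bounded B}"

(* The counting law is written out because the library's poisson_pmf is specified for positive
   rates only, while B may be a null set. *)
definition poisson_process ::
  "'w measure \<Rightarrow> real \<Rightarrow> ('w \<Rightarrow> 'a::euclidean_space set) \<Rightarrow> bool" where
  "poisson_process M lam X \<longleftrightarrow>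
     X \<in> measurable M config_space \<and>
     (\<forall>B k. B \<in> sets borel \<longrightarrow> bounded B \<longrightarrow>
        measure M {w \<in> space M. card (X w \<inter> B) = k} =
          (lam * measure lborel B) ^ k / fact k * exp (- (lam * measure lborel B))) \<and>
     (\<forall>(I :: nat set) B. finite I \<longrightarrow> disjoint_family_on B I \<longrightarrow>
        (\<forall>i\<in>I. B i \<in> sets borel \<and> bounded (B i)) \<longrightarrow>
        prob_space.indep_vars M (\<lambda>_. count_space UNIV) (\<lambda>i w. card (X w \<inter> B i)) I)"

section \<open>The iS-graph\<close>

(* Path loss only: the power gain of a link is a deterministic function g of its length.
   A gain may be singular at length 0, as r powr (-2b) is, so g 0 is irrelevant up to sign. *)
definition path_loss_gain :: "(real \<Rightarrow> real) \<Rightarrow> bool" where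
  "path_loss_gain g \<longleftrightarrow>
     (\<forall>r\<ge>0. 0 \<le> g r) \<and> continuous_on {0<..} g \<and>
     (\<forall>r s. 0 < r \<longrightarrow> r < s \<longrightarrow> g s < g r) \<and> (g \<longlongrightarrow> 0) at_top"

(* Power received, when x transmits with power P, by the eavesdropper in E with the strongest
   received signal. *)
definition eve_power ::
  "(real \<Rightarrow> real) \<Rightarrow> real \<Rightarrow> 'a::metric_space set \<Rightarrow> 'a \<Rightarrow> real" where
  "eve_power g P E x = (if E = {} then 0 else (SUP e\<in>E. P * g (dist x e)))"

(* Secrecy capacity of the Gaussian wiretap channel; wl and we are the noise powers of the
   legitimate nodes and of the eavesdroppers. *)
definition max_secrecy_rate ::
  "(real \<Rightarrow> real) \<Rightarrow> real \<Rightarrow> real \<Rightarrow> real \<Rightarrow> 'a::metric_space set \<Rightarrow> 'a \<Rightarrow> 'a \<Rightarrow> real" where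
  "max_secrecy_rate g P wl we E x y =
     max 0 (log 2 (1 + P * g (dist x y) / wl) - log 2 (1 + eve_power g P E x / we))"

definition is_graph_edges ::
  "(real \<Rightarrow> real) \<Rightarrow> real \<Rightarrow> real \<Rightarrow> real \<Rightarrow> real \<Rightarrow> 'a::metric_space set \<Rightarrow> 'a set \<Rightarrow> ('a \<times> 'a) set" where
  "is_graph_edges g P wl we rho L E =
     {(x, y). x \<in> L \<and> y \<in> L \<and> x \<noteq> y \<and> max_secrecy_rate g P wl we E x y > rho}"

(* Out-degree as a possibly infinite cardinality. *)
definition out_degree :: "('a \<times> 'a) set \<Rightarrow> 'a \<Rightarrow> ennreal" where
  "out_degree A x = emeasure (count_space UNIV) {y. (x, y) \<in> A}"

(* Out-degree of the typical node, for zero threshold and equal noise powers. *)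
definition typical_out_degree ::
  "(real \<Rightarrow> real) \<Rightarrow> real \<Rightarrow> real \<Rightarrow> 'a::real_normed_vector set \<Rightarrow> 'a set \<Rightarrow> ennreal" where
  "typical_out_degree g P noise L E =
     out_degree (is_graph_edges g P noise noise 0 (insert 0 L) E) 0"

lemma nearest_point_exists:
  assumes "locally_finite E" "E \<noteq> {}"
  obtains e where "e \<in> E" "\<And>e'. e' \<in> E \<Longrightarrow> dist x e \<le> dist x e'"
proof -
  obtain e1 where e1: "e1 \<in> E" using assms(2) by blast
  define F where "F = E \<inter> cball x (dist x e1)"
  have "finite F" using assms(1) by (simp add: F_def locally_finite_def)
  moreover have "F \<noteq> {}" using e1 by (auto simp: F_def)
  ultimately obtain e where e: "e \<in> F" "\<And>e'. e' \<in> F \<Longrightarrow> dist x e \<le> dist x e'"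
    using arg_min_if_finite[of F "dist x"] by (metis not_le)
  have "dist x e \<le> dist x e'" if "e' \<in> E" for e'
    using e that by (cases "e' \<in> F") (auto simp: F_def)
  with e(1) show thesis by (intro that[of e]) (auto simp: F_def)
qed

(* With equal noise powers the rate is positive iff the receiver is closer than every
   eavesdropper. *)
lemma max_secrecy_rate_pos_iff:
  assumes g: "path_loss_gain g" and P: "0 < P" and w: "0 < noise"
    and E: "locally_finite E" "E \<noteq> {}" "x \<notin> E" and xy: "x \<noteq> y"
  shows "0 < max_secrecy_rate g P noise noise E x y \<longleftrightarrow> dist x y < infdist x E"
proof -
  obtain e where e: "e \<in> E" "\<And>e'. e' \<in> E \<Longrightarrow> dist x e \<le> dist x e'"
    using nearest_point_exists[OF E(1,2)] by metis
  have anti: "g s < g r \<longleftrightarrow> r < s" if "0 < r" "0 < s" for r s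
    using g that unfolding path_loss_gain_def by (metis less_asym less_linear)
  have pos: "0 < dist x e'" if "e' \<in> E" for e' using that E(3) by auto
  have inf: "infdist x E = dist x e"
    unfolding infdist_notempty[OF E(2)] by (rule cInf_eq_minimum) (use e in auto)
  have "(SUP e\<in>E. P * g (dist x e)) = P * g (dist x e)"
  proof (rule cSup_eq_maximum)
    fix z assume "z \<in> (\<lambda>e. P * g (dist x e)) ` E"
    then obtain e' where e': "e' \<in> E" "z = P * g (dist x e')" by blast
    then have "g (dist x e') \<le> g (dist x e)"
      using anti[OF pos[OF e'(1)] pos[OF e(1)]] e(2)[OF e'(1)] by linarith
    then show "z \<le> P * g (dist x e)" using P e'(2) by simp
  qed (use e in auto)
  then have eve: "eve_power g P E x = P * g (dist x e)" using E(2) by (simp add: eve_power_def)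
  have nonneg: "0 \<le> P * g (dist u v) / noise" for u v :: 'a
    using g P w by (auto simp: path_loss_gain_def)
  have "0 < max_secrecy_rate g P noise noise E x y \<longleftrightarrow>
      log 2 (1 + P * g (dist x e) / noise) < log 2 (1 + P * g (dist x y) / noise)"
    by (auto simp: max_secrecy_rate_def eve)
  also have "\<dots> \<longleftrightarrow> 1 + P * g (dist x e) / noise < 1 + P * g (dist x y) / noise"
    using nonneg[of x e] nonneg[of x y] by (intro log_less_cancel_iff) auto
  also have "\<dots> \<longleftrightarrow> g (dist x e) < g (dist x y)"
    using P w by (simp add: divide_less_cancel)
  also have "\<dots> \<longleftrightarrow> dist x y < dist x e" using anti pos[OF e(1)] xy by simp
  finally show ?thesis by (simp add: inf)
qed

end

theory Submission
  imports Defs "HOL-Real_Asymp.Real_Asymp"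
begin

text \<open>Almost surely the out-neighbours of the origin are the legitimate nodes in the open disc
  reaching to the nearest eavesdropper. Its area \<open>V\<close> is exponentially distributed with rate
  \<open>\<lambda>\<^sub>e\<close>, since \<open>V\<close> exceeds \<open>a\<close> iff the closed disc of area \<open>a\<close> contains no eavesdropper. Given the
  eavesdroppers, the out-degree is Poisson with mean \<open>\<lambda>\<^sub>l V\<close> by independence, so its mean is
  \<open>\<lambda>\<^sub>l E(V)\<close> and the isolation probability is the Laplace transform \<open>E(exp(- \<lambda>\<^sub>l V))\<close>.\<close>

section \<open>Measurability on the configuration space\<close>

lemma space_config_space: "space config_space = {S. locally_finite S}"
  unfolding config_space_def by (subst space_measure_of) auto

lemma locally_finite_subset: "locally_finite S \<Longrightarrow> T \<subseteq> S \<Longrightarrow> locally_finite T"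
  unfolding locally_finite_def by (meson Int_mono finite_subset order_refl)

lemma locally_finiteD: "locally_finite S \<Longrightarrow> bounded B \<Longrightarrow> finite (S \<inter> B)"
  by (simp add: locally_finite_def)

lemma measurable_config_card [measurable]:
  assumes B: "B \<in> sets borel" "bounded B"
  shows "(\<lambda>S. card (S \<inter> B)) \<in> measurable config_space (count_space UNIV)"
  unfolding measurable_count_space_eq2_countable
proof (intro conjI ballI)
  fix k :: nat
  have "{S. locally_finite S \<and> card (S \<inter> B) = k} \<in> sets config_space"
    unfolding config_space_def using B by (subst sets_measure_of) auto
  moreover have "(\<lambda>S. card (S \<inter> B)) -` {k} \<inter> space config_space
      = {S. locally_finite S \<and> card (S \<inter> B) = k}"
    by (auto simp: space_config_space)
  ultimately show "(\<lambda>S. card (S \<inter> B)) -` {k} \<inter> space config_space \<in> sets config_space"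
    by simp
qed simp

text \<open>Counting \<open>S \<inter> B\<close> in a bounded set \<open>C\<close> is counting
  \<open>S\<close> in \<open>B \<inter> C\<close>, so generators pull back to sets given by
  generators. \<open>B\<close> itself may be unbounded: the lemma serves to delete the origin, or to
  keep only points of large gain.\<close>

lemma measurable_config_restrict:
  fixes B :: "'a::euclidean_space set"
  assumes B: "B \<in> sets borel"
  shows "(\<lambda>S. S \<inter> B) \<in> measurable config_space config_space"
proof -
  have "(\<lambda>S. S \<inter> B) \<in> measurable config_space (sigma {S. locally_finite S}
      {{S. locally_finite S \<and> card (S \<inter> B) = k} | (B :: 'a set) k. B \<in> sets borel \<and> bounded B})"
  proof (rule measurable_measure_of)
    fix Y :: "'a set set"
    assume "Y \<in> {{S. locally_finite S \<and> card (S \<inter> B) = k} | B k. B \<in> sets borel \<and> bounded B}"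
    then obtain C k where C: "C \<in> sets borel" "bounded C"
      and Y: "Y = {S. locally_finite S \<and> card (S \<inter> C) = k}" by blast
    have "(\<lambda>S. S \<inter> B) -` Y \<inter> space config_space
        = {S \<in> space config_space. card (S \<inter> (B \<inter> C)) = k}"
      by (auto simp: Y space_config_space Int_assoc intro: locally_finite_subset)
    moreover have [measurable]: "(\<lambda>S. card (S \<inter> (B \<inter> C))) \<in> measurable config_space (count_space UNIV)"
      using B C by (intro measurable_config_card) (auto intro: bounded_subset)
    have "{S \<in> space config_space. card (S \<inter> (B \<inter> C)) = k} \<in> sets config_space"
      by measurable
    ultimately show "(\<lambda>S. S \<inter> B) -` Y \<inter> space config_space \<in> sets config_space" by simp
  qed (auto simp: space_config_space intro: locally_finite_subset)
  then show ?thesis unfolding config_space_def[symmetric] .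
qed

text \<open>Emptiness concerns the whole, unbounded space, so it is expressed through the countable
  exhaustion by balls of integer radius.\<close>

lemma sets_config_empty:
  "{S \<in> space config_space. S = ({} :: 'a::euclidean_space set)} \<in> sets config_space"
proof -
  have "S = {} \<longleftrightarrow> (\<forall>n::nat. card (S \<inter> ball 0 (real n)) = 0)" if S: "locally_finite S" for S :: "'a set"
  proof
    assume *: "\<forall>n::nat. card (S \<inter> ball 0 (real n)) = 0"
    show "S = {}"
    proof (rule equals0I)
      fix x assume "x \<in> S"
      moreover obtain n where "norm x < real n" using reals_Archimedean2 by blast
      \<comment> \<open>\<open>card\<close> is 0 on infinite sets too; local finiteness turns count
        0 into emptiness.\<close>
      moreover have "S \<inter> ball 0 (real n) = {}"
        using * locally_finiteD[OF S bounded_ball, of 0 "real n"] by (metis card_0_eq)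
      ultimately show False by auto
    qed
  qed simp
  then have "{S \<in> space config_space. S = ({} :: 'a set)}
      = {S \<in> space config_space. \<forall>n::nat. card (S \<inter> ball 0 (real n)) = 0}"
    by (auto simp: space_config_space)
  also have "\<dots> \<in> sets config_space" by measurable
  finally show ?thesis .
qed

lemma sets_config_mem:
  "{S \<in> space config_space. (x :: 'a::euclidean_space) \<in> S} \<in> sets config_space"
proof -
  have "x \<in> S \<longleftrightarrow> card (S \<inter> {x}) = 1" for S by (auto simp: Int_insert_right)
  moreover have [measurable]: "(\<lambda>S. card (S \<inter> {x})) \<in> measurable config_space (count_space UNIV)"
    by (intro measurable_config_card) auto
  have "{S \<in> space config_space. card (S \<inter> {x}) = 1} \<in> sets config_space" by measurable
  ultimately show ?thesis by (simp only:)
qed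

section \<open>Distance to the nearest eavesdropper and the count of strictly nearer nodes\<close>

lemma infdist_origin_less_iff:
  fixes E :: "'a::euclidean_space set"
  assumes E: "locally_finite E" "E \<noteq> {}"
  shows "t < infdist 0 E \<longleftrightarrow> (\<forall>e\<in>E. t < norm e)"
proof -
  obtain e where e: "e \<in> E" "\<And>e'. e' \<in> E \<Longrightarrow> dist 0 e \<le> dist 0 e'"
    using nearest_point_exists[OF E] by metis
  \<comment> \<open>The infimum is attained, so strict inequality at every point yields strict
    inequality for \<open>infdist\<close>.\<close>
  have "infdist 0 E = dist 0 e"
    unfolding infdist_notempty[OF E(2)] by (rule cInf_eq_minimum) (use e in auto)
  with e show ?thesis by (auto intro: less_le_trans)
qed

lemma measurable_infdist_config [measurable]:
  "infdist (0 :: 'a::euclidean_space) \<in> borel_measurable config_space"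
proof (rule borel_measurableI_greater)
  fix t :: real
  show "{E \<in> space config_space. t < infdist (0::'a) E} \<in> sets config_space"
  proof (cases "t < 0")
    case True
    then have "{E \<in> space config_space. t < infdist (0::'a) E} = space config_space"
      using infdist_nonneg[of "0::'a"] by (auto intro: less_le_trans)
    then show ?thesis by simp
  next
    case False
    \<comment> \<open>The empty configuration has count 0 in every disc but must be excluded, since
      \<open>infdist 0 {}\<close> is 0 by convention.\<close>
    have "t < infdist 0 E \<longleftrightarrow> E \<noteq> {} \<and> card (E \<inter> cball 0 t) = 0" if "locally_finite E" for E :: "'a set"
      using False infdist_origin_less_iff[OF that, of t] locally_finiteD[OF that bounded_cball, of 0 t]
      by (cases "E = {}") (auto simp: infdist_def not_le)
    then have "{E \<in> space config_space. t < infdist (0::'a) E}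
        = {E \<in> space config_space. card (E \<inter> cball 0 t) = 0} - {E \<in> space config_space. E = {}}"
      by (auto simp: space_config_space)
    also have "\<dots> \<in> sets config_space"
      by (intro sets.Diff sets_config_empty) measurable
    finally show ?thesis .
  qed
qed

text \<open>This is the out-degree of the origin up to null events. Comparing norms instead of using
  \<open>infdist\<close> lets an empty \<open>E\<close> impose no constraint; all of a possibly
  infinite \<open>L\<close> then counts, whence the extended value.\<close>

definition near_count :: "'a::real_normed_vector set \<Rightarrow> 'a set \<Rightarrow> ennreal" where
  "near_count L E = emeasure (count_space UNIV) {x \<in> L. \<forall>e\<in>E. norm x < norm e}"

text \<open>Once \<open>E\<close> is fixed, this turns the out-degree into a count in a fixed disc,
  to which the Poisson law applies.\<close>

lemma near_count_eq_card:
  fixes L E :: "'a::euclidean_space set"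
  assumes "locally_finite L" "locally_finite E" "E \<noteq> {}"
  shows "near_count L E = of_nat (card (L \<inter> ball 0 (infdist 0 E)))"
proof -
  have "{x \<in> L. \<forall>e\<in>E. norm x < norm e} = L \<inter> ball 0 (infdist 0 E)"
    using infdist_origin_less_iff[OF assms(2,3)] by auto
  then show ?thesis
    using locally_finiteD[OF assms(1) bounded_ball] by (simp add: near_count_def)
qed

text \<open>The disc on the nearer nodes depends on \<open>E\<close>, whereas the sigma-algebra
  knows only counts in fixed sets. Exhausting that disc by discs of rational radius void of
  \<open>E\<close> gives a countable supremum of functions of such counts, hence joint
  measurability.\<close>

lemma near_count_eq_SUP:
  fixes L E :: "'a::euclidean_space set"
  assumes L: "locally_finite L" and E: "locally_finite E"
  shows "near_count L E =
    (SUP r\<in>\<rat>. if card (E \<inter> ball 0 r) = 0 then of_nat (card (L \<inter> ball 0 r)) else 0)"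
proof (rule antisym)
  let ?A = "{x \<in> L. \<forall>e\<in>E. norm x < norm e}"
  let ?f = "\<lambda>r. if card (E \<inter> ball 0 r) = 0 then of_nat (card (L \<inter> ball 0 r)) else 0 :: ennreal"
  have fin: "finite (S \<inter> ball 0 r)" if "locally_finite S" for S :: "'a set" and r
    by (rule locally_finiteD[OF that bounded_ball])
  show "(SUP r\<in>\<rat>. ?f r) \<le> near_count L E"
  proof (rule SUP_least)
    fix r :: real
    show "?f r \<le> near_count L E"
    proof (cases "card (E \<inter> ball 0 r) = 0")
      case True
      then have "E \<inter> ball 0 r = {}" using fin[OF E] by simp
      then have "\<forall>e\<in>E. r \<le> norm e" by (auto simp: disjoint_iff not_less)
      then have "L \<inter> ball 0 r \<subseteq> ?A" by force
      then have "emeasure (count_space UNIV) (L \<inter> ball 0 r) \<le> near_count L E"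
        unfolding near_count_def by (intro emeasure_mono) auto
      then show ?thesis using True fin[OF L] by simp
    qed simp
  qed
  \<comment> \<open>Every finite set of counted points fits into one void rational disc. This bounds
    the count when it is finite and makes the supremum infinite otherwise.\<close>
  have finite_le: "of_nat (card F) \<le> (SUP r\<in>\<rat>. ?f r)" if F: "finite F" "F \<subseteq> ?A" for F
  proof -
    have "\<exists>r\<in>\<rat>. (\<forall>x\<in>F. norm x < r) \<and> (\<forall>e\<in>E. r \<le> norm e)"
    proof (cases "F = {}")
      case True
      then show ?thesis by (intro bexI[of _ 0]) auto
    next
      case False
      define m where "m = Max (norm ` F)"
      have m: "norm x \<le> m" if "x \<in> F" for x using F(1) that by (simp add: m_def)
      have "m \<in> norm ` F" using F(1) False by (simp add: m_def)
      then have mE: "\<forall>e\<in>E. m < norm e" using F(2) by auto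
      \<comment> \<open>Points of \<open>E\<close> cannot accumulate at radius \<open>m\<close> from
        outside: local finiteness leaves a gap up to \<open>infdist 0 E\<close>.\<close>
      obtain b where b: "m < b" "\<forall>e\<in>E. b \<le> norm e"
      proof (cases "E = {}")
        case True
        then show thesis by (intro that[of "m + 1"]) auto
      next
        case False
        have "\<forall>e\<in>E. infdist 0 E \<le> norm e"
          using infdist_le[of _ E 0] by simp
        then show thesis using mE infdist_origin_less_iff[OF E False] by (intro that[of "infdist 0 E"]) auto
      qed
      obtain r where "r \<in> \<rat>" "m < r" "r < b" using Rats_dense_in_real[OF b(1)] by blast
      then show ?thesis using m b(2) by (intro bexI[of _ r]) force+
    qed
    then obtain r where r: "r \<in> \<rat>" "\<forall>x\<in>F. norm x < r" "\<forall>e\<in>E. r \<le> norm e" by blast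
    have "E \<inter> ball 0 r = {}" using r(3) by auto
    moreover have "card F \<le> card (L \<inter> ball 0 r)" using r(2) F(2) by (intro card_mono fin[OF L]) auto
    ultimately have "of_nat (card F) \<le> ?f r" by simp
    also have "\<dots> \<le> (SUP r\<in>\<rat>. ?f r)" using r(1) by (rule SUP_upper)
    finally show ?thesis .
  qed
  show "near_count L E \<le> (SUP r\<in>\<rat>. ?f r)"
  proof (cases "finite ?A")
    case True
    then show ?thesis using finite_le[OF True] by (simp add: near_count_def)
  next
    case False
    have "of_nat n \<le> (SUP r\<in>\<rat>. ?f r)" for n :: nat
    proof -
      obtain F where "finite F" "card F = n" "F \<subseteq> ?A"
        using infinite_arbitrarily_large[OF False, of n] by blast
      then show ?thesis using finite_le[of F] by simp
    qed
    then have "\<not> (SUP r\<in>\<rat>. ?f r) < \<top>"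
      by (meson ennreal_Ex_less_of_nat leD)
    then show ?thesis by (simp only: less_top[symmetric] not_not top_greatest)
  qed
qed

lemma measurable_near_count [measurable]:
  "(\<lambda>(L, E). near_count L E) \<in> borel_measurable
    (config_space \<Otimes>\<^sub>M (config_space :: 'a::euclidean_space set measure))"
proof -
  have [measurable]: "(\<lambda>p. card (fst p \<inter> ball (0::'a) r))
        \<in> measurable (config_space \<Otimes>\<^sub>M (config_space :: 'a set measure)) (count_space UNIV)"
      "(\<lambda>p. card (snd p \<inter> ball (0::'a) r))
        \<in> measurable ((config_space :: 'a set measure) \<Otimes>\<^sub>M config_space) (count_space UNIV)" for r
    by (intro measurable_compose[OF measurable_fst] measurable_compose[OF measurable_snd] measurable_config_card; simp)+
  have "(\<lambda>p. SUP r\<in>\<rat>. if card (snd p \<inter> ball (0::'a) r) = 0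
        then of_nat (card (fst p \<inter> ball 0 r)) else 0 :: ennreal)
      \<in> borel_measurable (config_space \<Otimes>\<^sub>M config_space)"
    by (rule borel_measurable_SUP[OF countable_rat]) measurable
  then show ?thesis
    by (rule measurable_cong[THEN iffD2, rotated])
      (auto simp: space_pair_measure space_config_space near_count_eq_SUP)
qed

section \<open>The out-degree of the typical node\<close>

lemma path_loss_gain_less_iff:
  assumes "path_loss_gain g" "0 < r" "0 < s"
  shows "g s < g r \<longleftrightarrow> r < s"
  using assms unfolding path_loss_gain_def by (metis less_asym less_linear)

lemma path_loss_gain_pos:
  assumes "path_loss_gain g" "0 < r"
  shows "0 < g r"
proof -
  have "0 \<le> g (r + 1)" "g (r + 1) < g r" using assms by (auto simp: path_loss_gain_def)
  then show ?thesis by linarith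
qed

text \<open>The eavesdropper set may contain the transmitter itself, where the gain is an arbitrary
  nonnegative number; this null event matters because measurability is claimed everywhere.\<close>

lemma max_secrecy_rate_pos_iff_gain:
  fixes E :: "'a::euclidean_space set"
  assumes g: "path_loss_gain g" and P: "0 < P" and w: "0 < noise"
    and E: "locally_finite E" and y: "y \<noteq> 0"
  shows "0 < max_secrecy_rate g P noise noise E 0 y \<longleftrightarrow> (\<forall>e\<in>E. g (norm e) < g (norm y))"
proof -
  have gy: "0 < g (norm y)" using path_loss_gain_pos[OF g] y by simp
  have nonneg: "0 \<le> g (norm v)" for v :: 'a using g by (auto simp: path_loss_gain_def)
  \<comment> \<open>\<open>p\<close> is the largest gain at an eavesdropper, or 0 if there is none;
    positivity of \<open>g (norm y)\<close> makes the equivalence hold in the latter case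
    too.\<close>
  obtain p where p: "eve_power g P E 0 = P * p" "0 \<le> p"
    and p_less: "p < g (norm y) \<longleftrightarrow> (\<forall>e\<in>E. g (norm e) < g (norm y))"
  proof (cases "E = {}")
    case True
    then show thesis using gy by (intro that[of 0]) (auto simp: eve_power_def)
  next
    case False
    \<comment> \<open>Away from the origin the nearest eavesdropper has the largest gain. It is
      compared with an eavesdropper at the origin, whose gain \<open>g 0\<close> is not tied to the
      others by monotonicity.\<close>
    obtain m where m: "m \<in> E" "\<And>e. e \<in> E \<Longrightarrow> g (norm e) \<le> g (norm m)"
    proof (cases "E - {0} = {}")
      case True
      then have "E = {0}" using False by auto
      then show thesis by (intro that[of 0]) auto
    next
      case nz: False
      have "locally_finite (E - {0})" using E by (rule locally_finite_subset) auto
      from nearest_point_exists[OF this nz, of 0] obtain n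
        where n: "n \<in> E - {0}" "\<And>e. e \<in> E - {0} \<Longrightarrow> norm n \<le> norm e"
        by (metis dist_0_norm)
      have le: "g (norm e) \<le> g (norm n)" if "e \<in> E - {0}" for e
        using n(2)[OF that] path_loss_gain_less_iff[OF g, of "norm e" "norm n"] that n(1)
        by fastforce
      show thesis
      proof (cases "0 \<in> E \<and> g (norm n) \<le> g 0")
        case True
        have "g (norm e) \<le> g (norm (0 :: 'a))" if "e \<in> E" for e
          using le[of e] that True by (cases "e = 0") auto
        with True show thesis by (intro that[of 0]) blast+
      next
        case False
        have "g (norm e) \<le> g (norm n)" if "e \<in> E" for e
          using le[of e] that False by (cases "e = 0") auto
        with n(1) show thesis by (intro that[of n]) blast+
      qed
    qed
    have "(SUP e\<in>E. P * g (dist 0 e)) = P * g (norm m)"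
      by (rule cSup_eq_maximum) (use m P in auto)
    then show thesis using False m nonneg
      by (intro that[of "g (norm m)"]) (auto simp: eve_power_def intro: le_less_trans)
  qed
  have "0 < max_secrecy_rate g P noise noise E 0 y \<longleftrightarrow>
      log 2 (1 + P * p / noise) < log 2 (1 + P * g (norm y) / noise)"
    by (auto simp: max_secrecy_rate_def p(1))
  also have "\<dots> \<longleftrightarrow> 1 + P * p / noise < 1 + P * g (norm y) / noise"
    using p(2) nonneg[of y] P w by (intro log_less_cancel_iff) (auto intro: add_pos_nonneg)
  also have "\<dots> \<longleftrightarrow> p < g (norm y)"
    using P w by (simp add: divide_less_cancel)
  finally show ?thesis by (simp add: p_less)
qed

text \<open>Away from the origin, comparing gains is comparing norms. An eavesdropper at the origin
  only adds the condition \<open>g 0 < g (norm y)\<close>, which is absorbed into a restriction of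
  \<open>L\<close>. The origin is deleted from \<open>L\<close> because edges join distinct
  nodes.\<close>

lemma typical_out_degree_eq:
  fixes L E :: "'a::euclidean_space set"
  assumes g: "path_loss_gain g" and "0 < P" "0 < noise" and E: "locally_finite E"
  shows "typical_out_degree g P noise L E =
    (if 0 \<in> E then near_count (L \<inter> {x. x \<noteq> 0 \<and> g 0 < g (norm x)}) (E \<inter> - {0})
     else near_count (L \<inter> - {0}) E)"
proof -
  have "typical_out_degree g P noise L E
      = emeasure (count_space UNIV) {y \<in> L. y \<noteq> 0 \<and> (\<forall>e\<in>E. g (norm e) < g (norm y))}"
    unfolding typical_out_degree_def out_degree_def is_graph_edges_def
    by (rule arg_cong[where f="emeasure _"])
      (use max_secrecy_rate_pos_iff_gain[OF assms] in auto)
  also have "{y \<in> L. y \<noteq> 0 \<and> (\<forall>e\<in>E. g (norm e) < g (norm y))} =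
    (if 0 \<in> E then {y \<in> L \<inter> {x. x \<noteq> 0 \<and> g 0 < g (norm x)}. \<forall>e\<in>E \<inter> - {0}. norm y < norm e}
     else {y \<in> L \<inter> - {0}. \<forall>e\<in>E. norm y < norm e})"
  proof -
    have less: "g (norm e) < g (norm y) \<longleftrightarrow> norm y < norm e" if "y \<noteq> 0" "e \<noteq> 0" for e y :: 'a
      using path_loss_gain_less_iff[OF g, of "norm y" "norm e"] that by simp
    show ?thesis
    proof (cases "0 \<in> E")
      case True
      obtain S where S: "E = insert 0 S" "0 \<notin> S" using mk_disjoint_insert[OF True] by blast
      then have "E \<inter> - {0} = S" by auto
      moreover have "(\<forall>e\<in>E. g (norm e) < g (norm y)) \<longleftrightarrow> g 0 < g (norm y) \<and> (\<forall>e\<in>S. norm y < norm e)"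
        if "y \<noteq> 0" for y :: 'a
      proof -
        have "(\<forall>e\<in>S. g (norm e) < g (norm y)) \<longleftrightarrow> (\<forall>e\<in>S. norm y < norm e)"
          using S(2) by (intro ball_cong refl less[OF that]) auto
        then show ?thesis by (simp add: S(1))
      qed
      ultimately show ?thesis using True by (simp only: if_True) blast
    next
      case False
      have "(\<forall>e\<in>E. g (norm e) < g (norm y)) \<longleftrightarrow> (\<forall>e\<in>E. norm y < norm e)" if "y \<noteq> 0" for y :: 'a
        using False by (intro ball_cong refl less[OF that]) auto
      then show ?thesis using False by (simp only: if_False) blast
    qed
  qed
  finally show ?thesis by (simp add: near_count_def)
qed

text \<open>The gain is continuous off the origin only, but the punctured space is open, so the
  superlevel set is open.\<close>

lemma gain_exceeds_borel:
  assumes "path_loss_gain g"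
  shows "{x :: 'a::euclidean_space. x \<noteq> 0 \<and> c < g (norm x)} \<in> sets borel"
proof -
  have "continuous_on {0<..} g" using assms by (simp add: path_loss_gain_def)
  then have "continuous_on (- {0 :: 'a}) (\<lambda>x. g (norm x))"
    by (rule continuous_on_compose2) (auto intro!: continuous_intros)
  then have "open ((\<lambda>x. g (norm x)) -` {c<..} \<inter> - {0 :: 'a})"
    by (subst (asm) continuous_on_open_vimage) auto
  moreover have "(\<lambda>x. g (norm x)) -` {c<..} \<inter> - {0 :: 'a} = {x. x \<noteq> 0 \<and> c < g (norm x)}" by auto
  ultimately show ?thesis by auto
qed

text \<open>Both cases of \<open>typical_out_degree_eq\<close> are \<open>near_count\<close> of
  restricted configurations, and the case condition is a measurable event.\<close>

lemma measurable_typical_out_degree: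
  assumes g: "path_loss_gain g" and P: "0 < P" "0 < noise"
    and [measurable]: "X \<in> measurable M config_space" "Y \<in> measurable M config_space"
  shows "(\<lambda>w. typical_out_degree g P noise (X w) (Y w :: 'a::euclidean_space set)) \<in> borel_measurable M"
proof -
  let ?G = "{x :: 'a. x \<noteq> 0 \<and> g 0 < g (norm x)}"
  have [measurable]: "(\<lambda>w. X w \<inter> ?G) \<in> measurable M config_space"
      "(\<lambda>w. X w \<inter> - {0}) \<in> measurable M config_space"
      "(\<lambda>w. Y w \<inter> - {0}) \<in> measurable M config_space"
    using gain_exceeds_borel[OF g]
    by (intro measurable_compose[OF _ measurable_config_restrict] assms; auto)+
  have nc: "(\<lambda>w. near_count (L w) (E w)) \<in> borel_measurable M"
    if "L \<in> measurable M config_space" "E \<in> measurable M config_space"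
    for L E :: "'b \<Rightarrow> 'a set"
    using measurable_compose[OF measurable_Pair[OF that] measurable_near_count] by simp
  have "Y -` {S \<in> space config_space. 0 \<in> S} \<inter> space M = {w \<in> space M. 0 \<in> Y w}"
    using measurable_space[OF assms(5)] by auto
  then have "Measurable.pred M (\<lambda>w. 0 \<in> Y w)"
    using measurable_sets[OF assms(5) sets_config_mem[of 0]] by (simp add: pred_def)
  then have "(\<lambda>w. if 0 \<in> Y w then near_count (X w \<inter> ?G) (Y w \<inter> - {0})
      else near_count (X w \<inter> - {0}) (Y w)) \<in> borel_measurable M"
    by (intro measurable_If nc) auto
  then show ?thesis
  proof (rule measurable_cong[THEN iffD2, rotated])
    fix w assume "w \<in> space M"
    then have "locally_finite (Y w)"
      using measurable_space[OF assms(5)] by (auto simp: space_config_space)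
    then show "typical_out_degree g P noise (X w) (Y w) = (if 0 \<in> Y w
      then near_count (X w \<inter> ?G) (Y w \<inter> - {0}) else near_count (X w \<inter> - {0}) (Y w))"
      by (rule typical_out_degree_eq[OF g P])
  qed
qed

section \<open>Poisson processes\<close>

lemma poisson_process_measurable [dest]:
  "poisson_process M lam X \<Longrightarrow> X \<in> measurable M config_space"
  by (simp add: poisson_process_def)

lemma poisson_process_card:
  assumes "poisson_process M lam X" "B \<in> sets borel" "bounded B"
  shows "measure M {w \<in> space M. card (X w \<inter> B) = k} =
    (lam * measure lborel B) ^ k / fact k * exp (- (lam * measure lborel B))"
  using assms unfolding poisson_process_def by blast

lemma poisson_process_measurable_card:
  assumes "poisson_process M lam X" "B \<in> sets borel" "bounded B"
  shows "(\<lambda>w. card (X w \<inter> B)) \<in> measurable M (count_space UNIV)"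
  using measurable_compose[OF poisson_process_measurable[OF assms(1)] measurable_config_card[OF assms(2,3)]] .

lemma poisson_process_locally_finite:
  assumes "poisson_process M lam X" "w \<in> space M"
  shows "locally_finite (X w)"
  using measurable_space[OF poisson_process_measurable[OF assms(1)] assms(2)] by (simp add: space_config_space)

text \<open>Local finiteness rules out that the count is 0 because the intersection is
  infinite.\<close>

lemma poisson_process_void_eq:
  assumes X: "poisson_process M lam X" and B: "bounded B"
  shows "{w \<in> space M. X w \<inter> B = {}} = {w \<in> space M. card (X w \<inter> B) = 0}"
  using locally_finiteD[OF poisson_process_locally_finite[OF X] B] by auto

lemma poisson_process_void_sets:
  assumes X: "poisson_process M lam X" and B: "B \<in> sets borel" "bounded B"
  shows "{w \<in> space M. X w \<inter> B = {}} \<in> sets M"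
proof -
  have [measurable]: "(\<lambda>w. card (X w \<inter> B)) \<in> measurable M (count_space UNIV)"
    using assms by (rule poisson_process_measurable_card)
  have "{w \<in> space M. card (X w \<inter> B) = 0} \<in> sets M" by measurable
  then show ?thesis by (simp only: poisson_process_void_eq[OF X B(2)])
qed

section \<open>Mean count and void probability of a Poisson process\<close>

lemma sums_poisson_mean:
  fixes x :: real
  shows "(\<lambda>k. real k * (x ^ k / fact k * exp (- x))) sums x"
proof -
  have "(\<lambda>k. x ^ k / fact k) sums exp x"
    using exp_converges[of x] by (simp add: field_simps)
  then have "(\<lambda>k. x * exp (- x) * (x ^ k / fact k)) sums (x * exp (- x) * exp x)"
    by (rule sums_mult)
  \<comment> \<open>The factor \<open>Suc k\<close> cancels against the factorial; the shift loses
    nothing because the term at index 0 vanishes.\<close>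
  moreover have "x * exp (- x) * (x ^ k / fact k) = real (Suc k) * (x ^ Suc k / fact (Suc k) * exp (- x))" for k
    by (simp del: of_nat_Suc)
  ultimately have "(\<lambda>k. real (Suc k) * (x ^ Suc k / fact (Suc k) * exp (- x))) sums x"
    by (simp only: mult.assoc exp_minus_inverse mult.commute[of "exp (- x)"]) (simp flip: exp_add)
  then show ?thesis by (subst (asm) sums_Suc_iff) simp
qed

text \<open>The count is decomposed over its values and integrated termwise, which leaves the mean
  of the Poisson law.\<close>

lemma (in prob_space) poisson_process_mean:
  assumes X: "poisson_process M lam X" "0 < lam" and B: "B \<in> sets borel" "bounded B"
  shows "(\<integral>\<^sup>+ w. of_nat (card (X w \<inter> B)) \<partial>M) = ennreal (lam * measure lborel B)"
proof -
  let ?x = "lam * measure lborel B"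
  have [measurable]: "(\<lambda>w. card (X w \<inter> B)) \<in> measurable M (count_space UNIV)"
    using X(1) B by (rule poisson_process_measurable_card)
  let ?A = "\<lambda>k. {w \<in> space M. card (X w \<inter> B) = k}"
  have "(\<integral>\<^sup>+ w. of_nat (card (X w \<inter> B)) \<partial>M) = (\<integral>\<^sup>+ w. (\<Sum>k. of_nat k * indicator (?A k) w) \<partial>M)"
  proof (rule nn_integral_cong)
    fix w assume w: "w \<in> space M"
    have "(\<Sum>k. of_nat k * indicator (?A k) w :: ennreal)
        = (\<Sum>k\<in>{card (X w \<inter> B)}. of_nat k * indicator (?A k) w)"
      by (rule suminf_finite) (auto simp: indicator_def)
    then show "of_nat (card (X w \<inter> B)) = (\<Sum>k. of_nat k * indicator (?A k) w :: ennreal)"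
      using w by simp
  qed
  also have "\<dots> = (\<Sum>k. \<integral>\<^sup>+ w. of_nat k * indicator (?A k) w \<partial>M)"
    by (rule nn_integral_suminf) measurable
  also have "\<dots> = (\<Sum>k. ennreal (real k * (?x ^ k / fact k * exp (- ?x))))"
  proof (rule suminf_cong)
    fix k
    have "(\<integral>\<^sup>+ w. of_nat k * indicator (?A k) w \<partial>M) = of_nat k * emeasure M (?A k)"
      by (rule nn_integral_cmult_indicator) measurable
    then show "(\<integral>\<^sup>+ w. of_nat k * indicator (?A k) w \<partial>M) = ennreal (real k * (?x ^ k / fact k * exp (- ?x)))"
      unfolding emeasure_eq_measure poisson_process_card[OF X(1) B]
      by (simp only: ennreal_of_nat_eq_real_of_nat ennreal_mult' of_nat_0_le_iff)
  qed
  also have "\<dots> = ennreal ?x"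
    using sums_poisson_mean[of ?x] X(2) by (intro sums_unique[symmetric]) simp
  finally show ?thesis .
qed

lemma (in prob_space) poisson_process_void:
  assumes X: "poisson_process M lam X" and B: "B \<in> sets borel" "bounded B"
  shows "prob {w \<in> space M. X w \<inter> B = {}} = exp (- (lam * measure lborel B))"
  unfolding poisson_process_void_eq[OF X B(2)] poisson_process_card[OF X B] by simp

text \<open>A singleton is Lebesgue null, so its void probability is \<open>exp 0\<close>.\<close>

lemma (in prob_space) AE_poisson_process_notin:
  assumes X: "poisson_process M lam X"
  shows "AE w in M. x \<notin> X w"
proof -
  have "AE w in M. w \<in> {w \<in> space M. X w \<inter> {x} = {}}"
    using poisson_process_void[OF X, of "{x}"] by (intro AE_prob_1) simp
  then show ?thesis by eventually_elim auto
qed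

section \<open>The area of the disc reaching to the nearest point\<close>

lemma measure_ball_real2: "0 \<le> r \<Longrightarrow> measure lborel (ball (x :: real ^ 2) r) = pi * r\<^sup>2"
  using content_ball[of r x] by (simp add: unit_ball_vol_2)

lemma measure_cball_real2: "0 \<le> r \<Longrightarrow> measure lborel (cball (x :: real ^ 2) r) = pi * r\<^sup>2"
  using content_cball[of r x] by (simp add: unit_ball_vol_2)

text \<open>An empty configuration leaves every disc void, and the void probability of a disc tends
  to 0 as its radius grows.\<close>

lemma (in prob_space) AE_poisson_process_nonempty:
  fixes X :: "'a \<Rightarrow> (real ^ 2) set"
  assumes X: "poisson_process M lam X" "0 < lam"
  shows "AE w in M. X w \<noteq> {}"
proof -
  have X_meas: "X \<in> measurable M config_space" using X(1) by blast
  have ev: "{w \<in> space M. X w = {}} \<in> events"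
  proof -
    have "X -` {S \<in> space config_space. S = {}} \<inter> space M = {w \<in> space M. X w = {}}"
      using measurable_space[OF X_meas] by auto
    then show ?thesis using measurable_sets[OF X_meas sets_config_empty] by simp
  qed
  have le: "prob {w \<in> space M. X w = {}} \<le> exp (- (lam * (pi * r\<^sup>2)))" if "0 \<le> r" for r
  proof -
    have "{w \<in> space M. X w \<inter> ball 0 r = {}} \<in> events"
      by (rule poisson_process_void_sets[OF X(1)]) auto
    then have "prob {w \<in> space M. X w = {}} \<le> prob {w \<in> space M. X w \<inter> ball 0 r = {}}"
      by (intro finite_measure_mono) auto
    then show ?thesis
      using poisson_process_void[OF X(1), of "ball 0 r"] measure_ball_real2[OF that] by simp
  qed
  have "((\<lambda>r. exp (- (lam * (pi * r\<^sup>2)))) \<longlongrightarrow> 0) at_top"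
    using X(2) by real_asymp
  then have "prob {w \<in> space M. X w = {}} \<le> 0"
    by (rule tendsto_lowerbound) (auto intro!: eventually_mono[OF eventually_ge_at_top[of 0]] le)
  then have "emeasure M {w \<in> space M. X w = {}} = 0"
    by (simp add: emeasure_eq_measure measure_le_0_iff)
  then show ?thesis by (intro AE_I[OF _ _ ev]) auto
qed

(* On the null event that X is empty, infdist takes the junk value 0. *)
lemma (in prob_space) poisson_process_nearest_exponential:
  fixes X :: "'a \<Rightarrow> (real ^ 2) set"
  assumes X: "poisson_process M lam X" "0 < lam"
  shows "distributed M lborel (\<lambda>w. pi * (infdist 0 (X w))\<^sup>2) (exponential_density lam)"
  unfolding exponential_distributed_iff[OF X(2)]
proof (intro conjI allI impI)
  have [measurable]: "X \<in> measurable M config_space" using X(1) by blast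
  show [measurable]: "(\<lambda>w. pi * (infdist 0 (X w))\<^sup>2) \<in> borel_measurable M" by measurable
  fix a :: real assume a: "0 \<le> a"
  \<comment> \<open>The radius of the disc of area \<open>a\<close>.\<close>
  define r where "r = sqrt (a / pi)"
  have r: "0 \<le> r" "pi * r\<^sup>2 = a" using a by (auto simp: r_def)
  have le_iff: "pi * (infdist 0 E)\<^sup>2 \<le> a \<longleftrightarrow> infdist 0 E \<le> r" for E :: "(real ^ 2) set"
  proof -
    have "pi * (infdist 0 E)\<^sup>2 \<le> a \<longleftrightarrow> (infdist 0 E)\<^sup>2 \<le> r\<^sup>2" by (simp flip: r(2))
    also have "\<dots> \<longleftrightarrow> infdist 0 E \<le> r" using r(1) infdist_nonneg[of 0 E] by (intro power_mono_iff) auto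
    finally show ?thesis .
  qed
  \<comment> \<open>The disc is closed because the nearest point must lie strictly beyond radius
    \<open>r\<close>; almost sure nonemptiness gives \<open>infdist\<close> its geometric
    meaning.\<close>
  have "AE w in M. r < infdist 0 (X w) \<longleftrightarrow> X w \<inter> cball 0 r = {}"
    using AE_poisson_process_nonempty[OF X] AE_space
  proof eventually_elim
    case (elim w)
    then show ?case
      using infdist_origin_less_iff[OF poisson_process_locally_finite[OF X(1)], of w r]
      by (auto simp: disjoint_iff not_le)
  qed
  moreover have "{w \<in> space M. X w \<inter> cball 0 r = {}} \<in> events"
    by (rule poisson_process_void_sets[OF X(1)]) auto
  ultimately have "\<P>(w in M. r < infdist 0 (X w)) = prob {w \<in> space M. X w \<inter> cball 0 r = {}}"
    by (intro prob_eq_AE) auto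
  also have "\<dots> = exp (- (lam * a))"
    using poisson_process_void[OF X(1), of "cball 0 r"] measure_cball_real2[OF r(1)] r(2) by simp
  finally have gt: "\<P>(w in M. r < infdist 0 (X w)) = exp (- (lam * a))" .
  have "\<P>(w in M. pi * (infdist 0 (X w))\<^sup>2 \<le> a) = 1 - \<P>(w in M. r < infdist 0 (X w))"
    unfolding le_iff by (subst prob_neg[symmetric]) (auto simp: not_less)
  then show "\<P>(w in M. pi * (infdist 0 (X w))\<^sup>2 \<le> a) = 1 - exp (- a * lam)"
    by (simp add: gt mult.commute)
qed

section \<open>Exponential integrals and integration over an independent pair\<close>

lemma (in prob_space) exponential_distributed_laplace:
  assumes V: "distributed M lborel V (exponential_density l)" and l: "0 < l" and s: "0 \<le> s"
  shows "(\<integral>\<^sup>+ w. ennreal (exp (- (s * V w))) \<partial>M) = ennreal (l / (s + l))"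
proof -
  have "(\<integral>\<^sup>+ w. ennreal (exp (- (s * V w))) \<partial>M)
      = (\<integral>\<^sup>+ x. ennreal (exponential_density l x) * ennreal (exp (- (s * x))) \<partial>lborel)"
    by (rule distributed_nn_integral[OF V, symmetric]) measurable
  also have "\<dots> = (\<integral>\<^sup>+ x. ennreal (l / (s + l)) * ennreal (exponential_density (s + l) x) \<partial>lborel)"
  proof (rule nn_integral_cong)
    fix x :: real
    \<comment> \<open>Exponential tilting: the weight turns the density of rate \<open>l\<close>
      into a multiple of the density of rate \<open>s + l\<close>, whose total mass is 1.\<close>
    have "exponential_density l x * exp (- (s * x)) = l / (s + l) * exponential_density (s + l) x"
    proof -
      have "exp (- x * l) * exp (- (s * x)) = exp (- x * (s + l))"
        by (simp add: algebra_simps flip: exp_add)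
      then show ?thesis using l s by (simp add: exponential_density_def)
    qed
    moreover have "0 \<le> exponential_density l x" using l by (rule exponential_density_nonneg)
    moreover have "0 \<le> exponential_density (s + l) x" using l s by (intro exponential_density_nonneg) simp
    ultimately show "ennreal (exponential_density l x) * ennreal (exp (- (s * x)))
        = ennreal (l / (s + l)) * ennreal (exponential_density (s + l) x)"
      using l s by (simp flip: ennreal_mult)
  qed
  also have "\<dots> = ennreal (l / (s + l)) * (\<integral>\<^sup>+ x. ennreal (exponential_density (s + l) x) \<partial>lborel)"
    by (rule nn_integral_cmult) measurable
  also have "(\<integral>\<^sup>+ x. ennreal (exponential_density (s + l) x) \<partial>lborel) = 1"
    using prob_space.emeasure_space_1[OF prob_space_exponential_density[of "s + l"]] l s
    by (simp add: emeasure_density)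
  finally show ?thesis by simp
qed

lemma (in prob_space) exponential_distributed_nn_mean:
  assumes V: "distributed M lborel V (exponential_density l)" and l: "0 < l"
    and nonneg: "\<And>w. 0 \<le> V w"
  shows "(\<integral>\<^sup>+ w. ennreal (V w) \<partial>M) = ennreal (1 / l)"
proof -
  \<comment> \<open>The exponential law is the Erlang law of shape 0.\<close>
  have "integrable M V" using erlang_ith_moment_integrable[OF l V, of 1] by simp
  then show ?thesis
    using exponential_distributed_expectation[OF l V] nonneg by (simp add: nn_integral_eq_integral)
qed

text \<open>Independence makes the joint law a product, so Tonelli applies. Sampling
  \<open>Y\<close> at \<open>v\<close> and \<open>X\<close> at a separate \<open>w\<close> does the
  work of conditioning on \<open>Y\<close>.\<close>

lemma (in prob_space) indep_var_nn_integral_iterated: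
  assumes ind: "indep_var S X T Y" and h [measurable]: "h \<in> borel_measurable (S \<Otimes>\<^sub>M T)"
  shows "(\<integral>\<^sup>+ w. h (X w, Y w) \<partial>M) = (\<integral>\<^sup>+ v. \<integral>\<^sup>+ w. h (X w, Y v) \<partial>M \<partial>M)"
proof -
  have [measurable]: "X \<in> measurable M S" "Y \<in> measurable M T"
    and eq: "distr M S X \<Otimes>\<^sub>M distr M T Y = distr M (S \<Otimes>\<^sub>M T) (\<lambda>x. (X x, Y x))"
    using ind unfolding indep_var_distribution_eq by auto
  interpret X: prob_space "distr M S X" by (rule prob_space_distr) measurable
  interpret Y: prob_space "distr M T Y" by (rule prob_space_distr) measurable
  interpret XY: pair_sigma_finite "distr M S X" "distr M T Y" ..
  have "(\<integral>\<^sup>+ w. h (X w, Y w) \<partial>M) = (\<integral>\<^sup>+ p. h p \<partial>(distr M S X \<Otimes>\<^sub>M distr M T Y))"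
    unfolding eq by (rule nn_integral_distr[symmetric]) measurable
  also have "\<dots> = (\<integral>\<^sup>+ y. \<integral>\<^sup>+ x. h (x, y) \<partial>distr M S X \<partial>distr M T Y)"
    by (rule XY.nn_integral_snd[symmetric]) measurable
  also have "\<dots> = (\<integral>\<^sup>+ v. \<integral>\<^sup>+ x. h (x, Y v) \<partial>distr M S X \<partial>M)"
    by (rule nn_integral_distr) measurable
  also have "\<dots> = (\<integral>\<^sup>+ v. \<integral>\<^sup>+ w. h (X w, Y v) \<partial>M \<partial>M)"
    by (intro nn_integral_cong nn_integral_distr) measurable
  finally show ?thesis .
qed

section \<open>Averaging the conditional Poisson law over the eavesdroppers\<close>

theorem corollary3p2:
  fixes M :: "'w measure"
    and X_l X_e :: "'w \<Rightarrow> (real ^ 2) set"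
    and lambda_l lambda_e P noise :: real
    and g :: "real \<Rightarrow> real"
  assumes "prob_space M"
    and "0 < lambda_l" and "0 < lambda_e"
    and "poisson_process M lambda_l X_l"
    and "poisson_process M lambda_e X_e"
    and "prob_space.indep_var M config_space X_l config_space X_e"
    and "path_loss_gain g" and "0 < P" and "0 < noise"
  shows "(\<lambda>w. typical_out_degree g P noise (X_l w) (X_e w)) \<in> borel_measurable M \<and>
    (\<integral>\<^sup>+ w. typical_out_degree g P noise (X_l w) (X_e w) \<partial>M) = ennreal (lambda_l / lambda_e) \<and>
    measure M {w \<in> space M. typical_out_degree g P noise (X_l w) (X_e w) = 0} =
      lambda_e / (lambda_l + lambda_e)"
proof -
  interpret prob_space M by fact
  note pos = assms(2,3) and Xl = assms(4) and Xe = assms(5) and ind = assms(6)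
  let ?N = "\<lambda>w. typical_out_degree g P noise (X_l w) (X_e w)"
  define V where "V w = pi * (infdist 0 (X_e w))\<^sup>2" for w
  have V: "distributed M lborel V (exponential_density lambda_e)"
    unfolding V_def by (rule poisson_process_nearest_exponential[OF Xe pos(2)])
  have V_nonneg: "0 \<le> V w" for w by (simp add: V_def)
  have [measurable]: "V \<in> borel_measurable M" using distributed_measurable[OF V] by simp
  have lf_l: "locally_finite (X_l w)" and lf_e: "locally_finite (X_e w)" if "w \<in> space M" for w
    using poisson_process_locally_finite[OF Xl that] poisson_process_locally_finite[OF Xe that] .
  have N_meas [measurable]: "?N \<in> borel_measurable M"
    by (rule measurable_typical_out_degree[OF assms(7-9)]) (use Xl Xe in blast)+
  \<comment> \<open>Almost surely neither process hits the origin, so only the second case of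
    \<open>typical_out_degree_eq\<close> remains and deleting the origin changes nothing.\<close>
  have N_AE: "AE w in M. ?N w = near_count (X_l w) (X_e w)"
    using AE_poisson_process_notin[OF Xl, of 0] AE_poisson_process_notin[OF Xe, of 0] AE_space
  proof eventually_elim
    case (elim w)
    then have "X_l w \<inter> - {0} = X_l w" by auto
    then show ?case using typical_out_degree_eq[OF assms(7-9) lf_e[OF elim(3)]] elim(2) by simp
  qed
  have ball: "measure lborel (ball (0 :: real ^ 2) (infdist 0 (X_e v))) = V v" for v
    unfolding V_def by (rule measure_ball_real2) (rule infdist_nonneg)

  have "(\<integral>\<^sup>+ w. ?N w \<partial>M) = (\<integral>\<^sup>+ w. near_count (X_l w) (X_e w) \<partial>M)"
    using N_AE by (rule nn_integral_cong_AE)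
  \<comment> \<open>The eavesdroppers are frozen at \<open>v\<close> while the legitimate nodes are
    averaged over \<open>w\<close>.\<close>
  also have "\<dots> = (\<integral>\<^sup>+ v. \<integral>\<^sup>+ w. near_count (X_l w) (X_e v) \<partial>M \<partial>M)"
    using indep_var_nn_integral_iterated[OF ind measurable_near_count] by simp
  also have "\<dots> = (\<integral>\<^sup>+ v. ennreal (lambda_l * V v) \<partial>M)"
  proof (rule nn_integral_cong_AE)
    \<comment> \<open>For nonempty \<open>X_e v\<close> the inner integrand is a count in a disc
      that does not depend on \<open>w\<close>, so \<open>poisson_process_mean\<close>
      applies.\<close>
    show "AE v in M. (\<integral>\<^sup>+ w. near_count (X_l w) (X_e v) \<partial>M) = ennreal (lambda_l * V v)"
      using AE_poisson_process_nonempty[OF Xe pos(2)] AE_space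
    proof eventually_elim
      case (elim v)
      have "(\<integral>\<^sup>+ w. near_count (X_l w) (X_e v) \<partial>M)
          = (\<integral>\<^sup>+ w. of_nat (card (X_l w \<inter> ball 0 (infdist 0 (X_e v)))) \<partial>M)"
        using elim lf_l lf_e by (intro nn_integral_cong near_count_eq_card)
      also have "\<dots> = ennreal (lambda_l * V v)"
        by (subst poisson_process_mean[OF Xl pos(1)]) (auto simp: ball)
      finally show ?case .
    qed
  qed
  also have "\<dots> = ennreal lambda_l * (\<integral>\<^sup>+ v. ennreal (V v) \<partial>M)"
    using pos(1) V_nonneg by (subst nn_integral_cmult[symmetric]) (auto simp: ennreal_mult)
  also have "\<dots> = ennreal (lambda_l / lambda_e)"
    using pos by (simp add: exponential_distributed_nn_mean[OF V pos(2) V_nonneg] flip: ennreal_mult)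
  finally have mean: "(\<integral>\<^sup>+ w. ?N w \<partial>M) = ennreal (lambda_l / lambda_e)" .

  have [measurable]: "(\<lambda>p. indicator {0} (case p of (L, E) \<Rightarrow> near_count L E) :: ennreal)
      \<in> borel_measurable (config_space \<Otimes>\<^sub>M (config_space :: (real ^ 2) set measure))"
    by (rule measurable_compose[OF measurable_near_count]) measurable
  \<comment> \<open>The isolation probability is written as an integral of an indicator so that the
    same iterated integration applies.\<close>
  have "emeasure M {w \<in> space M. ?N w = 0} = (\<integral>\<^sup>+ w. indicator {w \<in> space M. ?N w = 0} w \<partial>M)"
    by (rule nn_integral_indicator[symmetric]) measurable
  also have "\<dots> = (\<integral>\<^sup>+ w. indicator {0} (near_count (X_l w) (X_e w)) \<partial>M)"
  proof (rule nn_integral_cong_AE)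
    show "AE w in M. (indicator {w \<in> space M. ?N w = 0} w :: ennreal)
        = indicator {0} (near_count (X_l w) (X_e w))"
      using N_AE AE_space by eventually_elim (simp add: indicator_def)
  qed
  also have "\<dots> = (\<integral>\<^sup>+ v. \<integral>\<^sup>+ w. indicator {0} (near_count (X_l w) (X_e v)) \<partial>M \<partial>M)"
    using indep_var_nn_integral_iterated[OF ind,
      of "\<lambda>p. indicator {0} (case p of (L, E) \<Rightarrow> near_count L E)"] by simp
  also have "\<dots> = (\<integral>\<^sup>+ v. ennreal (exp (- (lambda_l * V v))) \<partial>M)"
  proof (rule nn_integral_cong_AE)
    \<comment> \<open>With \<open>v\<close> fixed, isolation means that the disc of area
      \<open>V v\<close> holds no legitimate node, a Poisson count equal to 0.\<close>
    show "AE v in M. (\<integral>\<^sup>+ w. indicator {0} (near_count (X_l w) (X_e v)) \<partial>M)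
        = ennreal (exp (- (lambda_l * V v)))"
      using AE_poisson_process_nonempty[OF Xe pos(2)] AE_space
    proof eventually_elim
      case (elim v)
      let ?B = "ball 0 (infdist 0 (X_e v))"
      have [measurable]: "(\<lambda>w. card (X_l w \<inter> ?B)) \<in> measurable M (count_space UNIV)"
        by (rule poisson_process_measurable_card[OF Xl]) auto
      have "(\<integral>\<^sup>+ w. indicator {0} (near_count (X_l w) (X_e v)) \<partial>M)
          = (\<integral>\<^sup>+ w. indicator {w \<in> space M. card (X_l w \<inter> ?B) = 0} w \<partial>M)"
        using elim lf_l lf_e
        by (intro nn_integral_cong) (auto simp: near_count_eq_card indicator_def)
      also have "\<dots> = emeasure M {w \<in> space M. card (X_l w \<inter> ?B) = 0}"
        by (rule nn_integral_indicator) measurable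
      also have "\<dots> = ennreal (exp (- (lambda_l * V v)))"
        by (simp add: emeasure_eq_measure poisson_process_card[OF Xl] ball)
      finally show ?case .
    qed
  qed
  \<comment> \<open>The Laplace transform of the exponential law of rate \<open>lambda_e\<close>,
    taken at \<open>lambda_l\<close>.\<close>
  also have "\<dots> = ennreal (lambda_e / (lambda_l + lambda_e))"
    using exponential_distributed_laplace[OF V pos(2)] pos(1) by simp
  finally have "measure M {w \<in> space M. ?N w = 0} = lambda_e / (lambda_l + lambda_e)"
    using pos by (simp add: measure_def)
  with N_meas mean show ?thesis by blast
qed

end
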